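(* The point reflection group $P$ is in a natural way isomorphic to the opposite group of Riemann's Schritte-Wechsel group $R$.
   Context: The (infinite) Tonnetz is the tiling of the Euclidean plane by congruent equilateral triangles with one family of edges horizontal. Fix an upward-pointing triangle $\Delta_0$ of the tiling. Upward-pointing triangles represent major triads and downward-pointing triangles represent minor triads. Point reflection group: $P$ is the subgroup of the group of isometries of the Euclidean plane (multiplication is composition of maps) generated by the $180^\circ$ rotations $\pi_1,\pi_2,\pi_3$ about the midpoints of the bottom (horizontal) edge, the left edge, and the right edge of $\Delta_0$, respectively. Schritte-Wechsel group: $R$ is the group of permutations of the set of triangles of the Tonnetz (multiplication is composition of maps) generated by the following three permutations. The Quintschritt translates each upward-pointing triangle by one edge length horizontally to the right and each downward-pointing triangle by one edge length horizontally to the left. The Terzschritt translates each upward-pointing triangle by one edge length in the direction at $60^\circ$ to the horizontal (to the upper right) and each downward-pointing triangle by one edge length in the opposite direction. The Seitenwechsel exchanges each triangle with the triangle adjacent to it along its horizontal edge. For a group $G$, the opposite group $G^{\mathrm{op}}$ has the same underlying set with multiplication $g\cdot_{\mathrm{op}}h=hg$. *)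

theory Defs
  imports "HOL-Analysis.Analysis" "HOL-Algebra.Algebra"
begin

text \<open>
  The Euclidean plane is the type \<^typ>\<open>complex\<close>, with the real axis as horizontal direction.
  The Tonnetz is determined by one of its vertices \<open>c\<close> and its edge length \<open>s > 0\<close>.
  Triangles are closed, filled triangles; both kinds are indexed by the left endpoint \<open>v\<close> of
  their horizontal edge, which is the bottom edge of an upward-pointing triangle and the top edge
  of a downward-pointing one.
\<close>

definition vertices :: "complex \<Rightarrow> real \<Rightarrow> complex set" where
  "vertices c s =
     {c + of_real s * (of_int m + of_int n * cis (pi / 3)) | m n :: int. True}"

definition up_triangle :: "real \<Rightarrow> complex \<Rightarrow> complex set" where
  "up_triangle s v = convex hull {v, v + of_real s, v + of_real s * cis (pi / 3)}"

definition down_triangle :: "real \<Rightarrow> complex \<Rightarrow> complex set" where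
  "down_triangle s v = convex hull {v, v + of_real s, v + of_real s * cis (- pi / 3)}"

definition up_triangles :: "complex \<Rightarrow> real \<Rightarrow> complex set set" where
  "up_triangles c s = up_triangle s ` vertices c s"

definition down_triangles :: "complex \<Rightarrow> real \<Rightarrow> complex set set" where
  "down_triangles c s = down_triangle s ` vertices c s"

definition triangles :: "complex \<Rightarrow> real \<Rightarrow> complex set set" where
  "triangles c s = up_triangles c s \<union> down_triangles c s"

definition horizontal_edges :: "complex \<Rightarrow> real \<Rightarrow> complex set set" where
  "horizontal_edges c s = (\<lambda>v. closed_segment v (v + of_real s)) ` vertices c s"

definition isometry_group :: "(complex \<Rightarrow> complex) monoid" where
  "isometry_group =
     \<lparr>carrier = {f. bij f \<and> (\<forall>x y. dist (f x) (f y) = dist x y)}, mult = (\<circ>), one = id\<rparr>"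

definition half_turn :: "complex \<Rightarrow> complex \<Rightarrow> complex" where
  "half_turn a z = a + cis pi * (z - a)"

text \<open>
  Here \<open>v\<close> is the lower left corner of the fixed upward-pointing triangle; the three centres
  are the midpoints of its bottom, left and right edge.
\<close>

definition point_reflection_group :: "real \<Rightarrow> complex \<Rightarrow> (complex \<Rightarrow> complex) monoid" where
  "point_reflection_group s v = subgroup_generated isometry_group
     {half_turn (midpoint v (v + of_real s)),
      half_turn (midpoint v (v + of_real s * cis (pi / 3))),
      half_turn (midpoint (v + of_real s) (v + of_real s * cis (pi / 3)))}"

text \<open>
  Permutations of the set of triangles are elements of \<^const>\<open>BijGroup\<close>, hence extensional
  functions.
\<close>

definition schritt :: "complex \<Rightarrow> real \<Rightarrow> complex \<Rightarrow> complex set \<Rightarrow> complex set" where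
  "schritt c s d = (\<lambda>t\<in>triangles c s.
     if t \<in> up_triangles c s then (\<lambda>z. z + d) ` t else (\<lambda>z. z - d) ` t)"

definition quintschritt :: "complex \<Rightarrow> real \<Rightarrow> complex set \<Rightarrow> complex set" where
  "quintschritt c s = schritt c s (of_real s)"

definition terzschritt :: "complex \<Rightarrow> real \<Rightarrow> complex set \<Rightarrow> complex set" where
  "terzschritt c s = schritt c s (of_real s * cis (pi / 3))"

definition seitenwechsel :: "complex \<Rightarrow> real \<Rightarrow> complex set \<Rightarrow> complex set" where
  "seitenwechsel c s = (\<lambda>t\<in>triangles c s.
     THE t'. t' \<in> triangles c s \<and> t' \<noteq> t \<and> (\<exists>e\<in>horizontal_edges c s. e \<subseteq> t \<and> e \<subseteq> t'))"

definition schritte_wechsel_group ::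
    "complex \<Rightarrow> real \<Rightarrow> (complex set \<Rightarrow> complex set) monoid" where
  "schritte_wechsel_group c s = subgroup_generated (BijGroup (triangles c s))
     {quintschritt c s, terzschritt c s, seitenwechsel c s}"

definition opposite_group :: "('a, 'b) monoid_scheme \<Rightarrow> ('a, 'b) monoid_scheme" where
  "opposite_group G = G\<lparr>mult := \<lambda>g h. h \<otimes>\<^bsub>G\<^esub> g\<rparr>"

end

theory Submission
  imports Defs
begin

text \<open>
  Both groups act on the set of triangles: a point reflection moves a triangle as a set of points,
  and a Schritt or Wechsel permutes triangles by definition. The two actions commute. A
  translation preserves orientation and moves every vertex by the same vector, so it does not
  affect what a Schritt does; a half-turn exchanges up and down and reverses every vector, and a
  Schritt moves the two kinds of triangles in opposite directions, so the two reversals cancel;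
  and every motion of the group maps horizontal edges to horizontal edges, hence respects the
  Seitenwechsel.

  Each action is transitive. The composites of two of the half-turns include translations along
  two adjacent edges of the tiling, so the point reflection group contains all translations in the
  lattice, which connect triangles of the same orientation, and a half-turn connects the two
  orientations. Likewise the Schritte connect triangles of the same orientation, and the
  Seitenwechsel exchanges the orientations. Both actions are also faithful.

  Two faithful, transitive and commuting actions are automatically free, since an element fixing
  one point fixes all its images under the other group. Given a base point, here the triangle with
  lower left corner \<open>v\<close>, each group is then in bijection with the set of triangles. Matching
  \<open>p\<close> with the \<open>r\<close> that moves the base triangle to the same place is a bijection of the groups.
  It reverses products because \<open>p (p' t) = p (r' t) = r' (p t) = r' (r t)\<close>. The abstract part of
  this argument is \<open>commuting_transitive_actions_anti_iso\<close>; its hypotheses are supplied by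
  \<open>point_reflection_group_actions\<close>, \<open>schritte_wechsel_group_actions\<close> and \<open>actions_commute\<close>.
\<close>

section \<open>Group actions and commuting permutations\<close>

text \<open>
  Every point is \<open>\<beta> h x\<close> for some \<open>h\<close>, and \<open>\<beta> h\<close> carries the coincidence of \<open>\<alpha> g\<close> and \<open>\<alpha> g'\<close>
  at \<open>x\<close> over to that point; so the two permutations agree everywhere.
\<close>

lemma transitive_commuting_imp_free:
  assumes G: "faithful_action G E \<alpha>" and H: "transitive_action H E \<beta>"
    and comm: "\<And>g h x. \<lbrakk>g \<in> carrier G; h \<in> carrier H; x \<in> E\<rbrakk> \<Longrightarrow> \<alpha> g (\<beta> h x) = \<beta> h (\<alpha> g x)"
    and x: "x \<in> E" and g: "g \<in> carrier G" "g' \<in> carrier G" and eq: "\<alpha> g x = \<alpha> g' x"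
  shows "g = g'"
proof -
  interpret G: faithful_action G E \<alpha> by fact
  interpret H: transitive_action H E \<beta> by fact
  have "\<alpha> g y = \<alpha> g' y" if y: "y \<in> E" for y
  proof -
    obtain h where h: "h \<in> carrier H" "\<beta> h x = y"
      using H.unique_orbit[OF x y] by blast
    show ?thesis
      using comm[OF g(1) h(1) x] comm[OF g(2) h(1) x] h(2) eq by simp
  qed
  then have "\<alpha> g = \<alpha> g'"
    by (rule extensionalityI[OF Bij_imp_extensional Bij_imp_extensional, OF G.bij_prop0 G.bij_prop0, OF g])
  then show ?thesis
    by (rule inj_onD[OF G.faithful _ g])
qed

text \<open>
  This generalizes the commuting left and right regular actions of a group on itself. Free
  transitivity of \<open>\<beta>\<close> makes \<open>\<phi> g\<close> the only element of \<open>H\<close> that moves the base point as \<open>g\<close> does.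
  The product is reversed because \<open>g\<close> has to be moved past \<open>\<beta> (\<phi> g')\<close> before it meets the base
  point.
\<close>

proposition commuting_transitive_actions_anti_iso:
  assumes Gf: "faithful_action G E \<alpha>" and Gt: "transitive_action G E \<alpha>"
    and Hf: "faithful_action H E \<beta>" and Ht: "transitive_action H E \<beta>"
    and comm: "\<And>g h x. \<lbrakk>g \<in> carrier G; h \<in> carrier H; x \<in> E\<rbrakk> \<Longrightarrow> \<alpha> g (\<beta> h x) = \<beta> h (\<alpha> g x)"
    and x: "x \<in> E"
  shows "\<exists>\<phi> \<in> iso G (opposite_group H).
           \<forall>g \<in> carrier G. \<forall>h \<in> carrier H. \<phi> g = h \<longleftrightarrow> \<beta> h x = \<alpha> g x"
proof -
  interpret G: transitive_action G E \<alpha> by fact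
  interpret H: transitive_action H E \<beta> by fact
  interpret GG: group G
    using G.group_hom group_hom.axioms(1) by blast
  interpret HG: group H
    using H.group_hom group_hom.axioms(1) by blast
  have G_free: "g = g'" if "g \<in> carrier G" "g' \<in> carrier G" "\<alpha> g x = \<alpha> g' x" for g g'
    using transitive_commuting_imp_free[OF Gf Ht comm x that] by simp
  have H_free: "h = h'" if "h \<in> carrier H" "h' \<in> carrier H" "\<beta> h x = \<beta> h' x" for h h'
    using transitive_commuting_imp_free[OF Hf Gt comm[symmetric] x that] by simp
  have "\<exists>h. h \<in> carrier H \<and> \<beta> h x = \<alpha> g x" if "g \<in> carrier G" for g
    using H.unique_orbit[OF x] G.element_image[OF that x] by blast
  then obtain \<phi> where \<phi>: "\<And>g. g \<in> carrier G \<Longrightarrow> \<phi> g \<in> carrier H"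
      "\<And>g. g \<in> carrier G \<Longrightarrow> \<beta> (\<phi> g) x = \<alpha> g x"
    by metis
  have "\<phi> (g \<otimes>\<^bsub>G\<^esub> g') = \<phi> g' \<otimes>\<^bsub>H\<^esub> \<phi> g"
    if g: "g \<in> carrier G" and g': "g' \<in> carrier G" for g g'
  proof (rule H_free)
    have "\<beta> (\<phi> (g \<otimes>\<^bsub>G\<^esub> g')) x = \<alpha> g (\<alpha> g' x)"
      using \<phi> g g' x G.composition_rule by simp
    also have "\<dots> = \<alpha> g (\<beta> (\<phi> g') x)"
      using \<phi> g' by simp
    also have "\<dots> = \<beta> (\<phi> g') (\<beta> (\<phi> g) x)"
      using \<phi> g g' x comm[of g "\<phi> g'" x] by simp
    finally show "\<beta> (\<phi> (g \<otimes>\<^bsub>G\<^esub> g')) x = \<beta> (\<phi> g' \<otimes>\<^bsub>H\<^esub> \<phi> g) x"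
      using \<phi> g g' x H.composition_rule by simp
  qed (use \<phi> g g' in auto)
  moreover have "bij_betw \<phi> (carrier G) (carrier H)"
  proof (intro bij_betw_imageI inj_onI equalityI subsetI)
    show "g = g'" if "g \<in> carrier G" "g' \<in> carrier G" "\<phi> g = \<phi> g'" for g g'
      using G_free that \<phi> by metis
    show "h \<in> \<phi> ` carrier G" if h: "h \<in> carrier H" for h
    proof -
      obtain g where "g \<in> carrier G" "\<alpha> g x = \<beta> h x"
        using G.unique_orbit[OF x] H.element_image[OF h x] by blast
      then show ?thesis
        using H_free \<phi> h by (metis imageI)
    qed
  qed (use \<phi> in auto)
  ultimately have "\<phi> \<in> iso G (opposite_group H)"
    using \<phi> by (auto simp: iso_def hom_def opposite_group_def)
  moreover have "\<phi> g = h \<longleftrightarrow> \<beta> h x = \<alpha> g x" if "g \<in> carrier G" "h \<in> carrier H" for g h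
    using \<phi> H_free that by metis
  ultimately show ?thesis by blast
qed

text \<open>
  The centralizer of \<open>a\<close> is a subgroup. This reduces commutation with a whole generated group to
  its generators.
\<close>

lemma (in group) commutes_with_subgroup_generated:
  assumes a: "a \<in> carrier G" and S: "\<And>b. b \<in> S \<Longrightarrow> b \<in> carrier G \<Longrightarrow> a \<otimes> b = b \<otimes> a"
    and b: "b \<in> carrier (subgroup_generated G S)"
  shows "a \<otimes> b = b \<otimes> a"
proof -
  have "subgroup {b \<in> carrier G. a \<otimes> b = b \<otimes> a} G"
  proof (rule subgroupI)
    fix b assume "b \<in> {b \<in> carrier G. a \<otimes> b = b \<otimes> a}"
    then have b: "b \<in> carrier G" "a \<otimes> b = b \<otimes> a"
      by auto
    have "a \<otimes> inv b = inv b \<otimes> (b \<otimes> a) \<otimes> inv b"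
      using a b(1) by (simp flip: m_assoc)
    also have "\<dots> = inv b \<otimes> a"
      using a b(1) by (simp add: m_assoc flip: b(2))
    finally show "inv b \<in> {b \<in> carrier G. a \<otimes> b = b \<otimes> a}"
      using b(1) by simp
  next
    fix b b' assume "b \<in> {b \<in> carrier G. a \<otimes> b = b \<otimes> a}" "b' \<in> {b \<in> carrier G. a \<otimes> b = b \<otimes> a}"
    then show "b \<otimes> b' \<in> {b \<in> carrier G. a \<otimes> b = b \<otimes> a}"
      using a by auto (metis m_assoc)
  next
    have "\<one> \<in> {b \<in> carrier G. a \<otimes> b = b \<otimes> a}"
      using a by simp
    then show "{b \<in> carrier G. a \<otimes> b = b \<otimes> a} \<noteq> {}"
      by blast
  qed auto
  then have "carrier (subgroup_generated G S) \<subseteq> {b \<in> carrier G. a \<otimes> b = b \<otimes> a}"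
    unfolding carrier_subgroup_generated
    by (rule generate_subgroup_incl[rotated]) (use S in auto)
  then show ?thesis
    using b by blast
qed

lemma BijI:
  assumes "f \<in> extensional E" "\<And>x. x \<in> E \<Longrightarrow> f x \<in> E" "\<And>x. x \<in> E \<Longrightarrow> g x \<in> E"
    "\<And>x. x \<in> E \<Longrightarrow> g (f x) = x" "\<And>x. x \<in> E \<Longrightarrow> f (g x) = x"
  shows "f \<in> Bij E"
  unfolding Bij_def using assms by (auto intro!: bij_betw_byWitness[where f' = g])

lemma BijGroup_mult: "f \<in> Bij E \<Longrightarrow> g \<in> Bij E \<Longrightarrow> f \<otimes>\<^bsub>BijGroup E\<^esub> g = compose E f g"
  by (simp add: BijGroup_def)

lemma carrier_BijGroup: "carrier (BijGroup E) = Bij E"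
  by (simp add: BijGroup_def)

text \<open>
  Transitivity needs checking only from a base point: go back from \<open>y\<close> to \<open>x\<close>, then on to \<open>z\<close>.
\<close>

lemma transitive_actionI:
  assumes "group_action G E \<phi>" and x: "x \<in> E"
    and orbit: "\<And>y. y \<in> E \<Longrightarrow> \<exists>g \<in> carrier G. \<phi> g x = y"
  shows "transitive_action G E \<phi>"
proof -
  interpret group_action G E \<phi> by fact
  interpret group G
    using group_hom group_hom.axioms(1) by blast
  show ?thesis
  proof
    fix y z assume "y \<in> E" "z \<in> E"
    then obtain g h where gh: "g \<in> carrier G" "\<phi> g x = y" "h \<in> carrier G" "\<phi> h x = z"
      using orbit by meson
    then have "\<phi> (h \<otimes>\<^bsub>G\<^esub> inv\<^bsub>G\<^esub> g) y = z"
      using composition_rule[OF \<open>y \<in> E\<close>, of h "inv\<^bsub>G\<^esub> g"] orbit_sym_aux[OF _ x] by simp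
    then show "\<exists>g \<in> carrier G. \<phi> g y = z"
      using gh by (blast intro: m_closed inv_closed)
  qed
qed

section \<open>The lattice of the Tonnetz\<close>

text \<open>
  The vectors of the translations that preserve the tiling.
\<close>

definition periods :: "real \<Rightarrow> complex set" where
  "periods s = {of_real s * (of_int m + of_int n * cis (pi / 3)) | m n :: int. True}"

lemma periods_zero: "0 \<in> periods s"
  unfolding periods_def by (auto intro!: exI[of _ 0])

lemma periods_add: "x \<in> periods s \<Longrightarrow> y \<in> periods s \<Longrightarrow> x + y \<in> periods s"
  unfolding periods_def
proof clarify
  fix m n m' n' :: int
  show "\<exists>k l. of_real s * (of_int m + of_int n * cis (pi / 3)) +
      of_real s * (of_int m' + of_int n' * cis (pi / 3)) =
      of_real s * (of_int k + of_int l * cis (pi / 3)) \<and> True"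
    by (rule exI[of _ "m + m'"], rule exI[of _ "n + n'"]) (simp add: algebra_simps)
qed

lemma periods_uminus: "x \<in> periods s \<Longrightarrow> - x \<in> periods s"
  unfolding periods_def
proof clarify
  fix m n :: int
  show "\<exists>k l. - (of_real s * (of_int m + of_int n * cis (pi / 3))) =
      of_real s * (of_int k + of_int l * cis (pi / 3)) \<and> True"
    by (rule exI[of _ "- m"], rule exI[of _ "- n"]) (simp add: algebra_simps)
qed

lemma periods_diff: "x \<in> periods s \<Longrightarrow> y \<in> periods s \<Longrightarrow> x - y \<in> periods s"
  using periods_add[of x s "- y"] periods_uminus by simp

lemma periods_generators: "of_real s \<in> periods s" "of_real s * cis (pi / 3) \<in> periods s"
proof -
  show "of_real s \<in> periods s"
    unfolding periods_def by (rule CollectI, rule exI[of _ 1], rule exI[of _ 0]) simp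
  show "of_real s * cis (pi / 3) \<in> periods s"
    unfolding periods_def by (rule CollectI, rule exI[of _ 0], rule exI[of _ 1]) simp
qed

lemma int_multiple_closed:
  fixes x :: "'a::ring_1"
  assumes "x \<in> D" and "0 \<in> D" and add: "\<And>y z. y \<in> D \<Longrightarrow> z \<in> D \<Longrightarrow> y + z \<in> D"
    and uminus: "\<And>y. y \<in> D \<Longrightarrow> - y \<in> D"
  shows "of_int m * x \<in> D"
proof (induction m rule: int_induct[of _ 0])
  case (step1 i)
  then show ?case
    using add \<open>x \<in> D\<close> by (simp add: algebra_simps)
next
  case (step2 i)
  then have "of_int i * x + - x \<in> D"
    using add uminus \<open>x \<in> D\<close> by blast
  then show ?case
    by (simp add: algebra_simps)
qed (use assms in simp)

text \<open>
  An induction principle: it shows that the translations, or Schritte, lying in a given group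
  include one for every lattice vector.
\<close>

lemma periods_minimal:
  assumes "of_real s \<in> D" "of_real s * cis (pi / 3) \<in> D" "0 \<in> D"
    and "\<And>x y. x \<in> D \<Longrightarrow> y \<in> D \<Longrightarrow> x + y \<in> D" "\<And>x. x \<in> D \<Longrightarrow> - x \<in> D"
  shows "periods s \<subseteq> D"
proof
  fix x assume "x \<in> periods s"
  then obtain m n :: int where x: "x = of_int m * of_real s + of_int n * (of_real s * cis (pi / 3))"
    by (auto simp: periods_def algebra_simps)
  show "x \<in> D"
    unfolding x using assms by (intro assms int_multiple_closed) auto
qed

lemma vertices_iff: "w \<in> vertices c s \<longleftrightarrow> w - c \<in> periods s"
proof -
  have "w = c + x \<longleftrightarrow> w - c = x" for x :: complex
    by auto
  then show ?thesis
    by (simp add: vertices_def periods_def)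
qed

lemma vertices_add: "w \<in> vertices c s \<Longrightarrow> d \<in> periods s \<Longrightarrow> w + d \<in> vertices c s"
  using periods_add[of "w - c" s d] by (simp add: vertices_iff algebra_simps)

lemma vertices_diff_period: "w \<in> vertices c s \<Longrightarrow> d \<in> periods s \<Longrightarrow> w - d \<in> vertices c s"
  using vertices_add[of w c s "- d"] periods_uminus by simp

lemma vertices_diff: "w \<in> vertices c s \<Longrightarrow> w' \<in> vertices c s \<Longrightarrow> w - w' \<in> periods s"
  using periods_diff[of "w - c" s "w' - c"] by (simp add: vertices_iff)

section \<open>Triangles in coordinates\<close>

text \<open>
  The imaginary part rescaled so that the edge vector \<open>of_real s * cis (pi / 3)\<close> has height \<open>s\<close>.
  Triangles are then cut out by linear inequalities with rational coefficients, within the reach of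
  linear arithmetic.
\<close>

definition height :: "complex \<Rightarrow> real" where
  "height z = 2 / sqrt 3 * Im z"

lemma height_simps [simp]:
  "height (x + y) = height x + height y" "height (- x) = - height x"
  "height (x - y) = height x - height y" "height (of_real r) = 0"
  "height (r *\<^sub>R x) = r * height x"
  "height (of_real r * cis (pi / 3)) = r" "height (of_real r * cis (- pi / 3)) = - r"
  "height (of_real r * cis (- (pi / 3))) = - r"
  by (simp_all add: height_def sin_60 field_simps)

lemma Re_cis_60 [simp]:
  "Re (of_real r * cis (pi / 3)) = r / 2" "Re (of_real r * cis (- pi / 3)) = r / 2"
  "Re (of_real r * cis (- (pi / 3))) = r / 2"
  by (simp_all add: cos_60)

lemma complex_eq_height: "x = y \<longleftrightarrow> Re x = Re y \<and> height x = height y"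
  by (simp add: height_def complex_eq_iff)

lemma up_triangle_iff:
  assumes "s > 0"
  shows "z \<in> up_triangle s w \<longleftrightarrow> height w \<le> height z \<and>
    height z - height w \<le> 2 * (Re z - Re w) \<and> 2 * (Re z - Re w) + (height z - height w) \<le> 2 * s"
    (is "_ \<longleftrightarrow> ?R")
proof
  assume "z \<in> up_triangle s w"
  then obtain p q where "z = w + p *\<^sub>R of_real s + q *\<^sub>R (of_real s * cis (pi / 3))"
      and pq: "0 \<le> p" "0 \<le> q" "p + q \<le> 1"
    by (auto simp: up_triangle_def convex_hull_3_alt)
  then have "Re z = Re w + p * s + q * s / 2" "height z = height w + q * s"
    by (simp_all add: cos_60)
  moreover have "0 \<le> p * s" "0 \<le> q * s" "p * s + q * s \<le> s"
    using pq assms mult_right_mono[of "p + q" 1 s] by (simp_all add: distrib_right)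
  ultimately show ?R by auto
next
  assume R: ?R
  define q where "q = (height z - height w) / s"
  define p where "p = (Re z - Re w) / s - q / 2"
  have "z = w + p *\<^sub>R of_real s + q *\<^sub>R (of_real s * cis (pi / 3))"
    using assms by (simp add: complex_eq_height p_def q_def cos_60 field_simps)
  moreover have "0 \<le> p" "0 \<le> q" "p + q \<le> 1"
    using R assms by (simp_all add: p_def q_def divide_simps)
  ultimately show "z \<in> up_triangle s w"
    by (auto simp: up_triangle_def convex_hull_3_alt)
qed

text \<open>
  Triangles are indexed by the left endpoint of the horizontal edge. A half-turn makes the image of
  the right endpoint the new left one, which explains the shift by \<open>s\<close>.
\<close>

lemma half_turn_up_triangle:
  "(\<lambda>z. a - z) ` up_triangle s w = down_triangle s (a - w - of_real s)"
  and half_turn_down_triangle: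
  "(\<lambda>z. a - z) ` down_triangle s w = up_triangle s (a - w - of_real s)"
  and translate_up_triangle: "(\<lambda>z. z + d) ` up_triangle s w = up_triangle s (w + d)"
  and translate_down_triangle: "(\<lambda>z. z + d) ` down_triangle s w = down_triangle s (w + d)"
proof -
  have *: "(\<lambda>z. z + d) ` (convex hull S) = convex hull ((\<lambda>z. z + d) ` S)" for d and S :: "complex set"
    using convex_hull_translation[of d S] by (simp add: add.commute)
  have "(\<lambda>z. a - z) ` (convex hull S) = (\<lambda>z. z + a) ` (uminus ` (convex hull S))" for S :: "complex set"
    by (simp add: image_image)
  moreover have "uminus ` (convex hull S) = convex hull (uminus ` S)" for S :: "complex set"
    by (intro convex_hull_linear_image linear_uminus)
  ultimately have **: "(\<lambda>z. a - z) ` (convex hull S) = convex hull ((\<lambda>z. a - z) ` S)" for S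
    by (simp add: * image_image)
  \<comment> \<open>The images of the corners, written relative to the left endpoint of the image edge.\<close>
  have e: "a - w = a - w - of_real s + of_real s"
    "a - (w + of_real s * cis (pi / 3)) = a - w - of_real s + of_real s * cis (- pi / 3)"
    "a - (w + of_real s * cis (- pi / 3)) = a - w - of_real s + of_real s * cis (pi / 3)"
    "a - (w + of_real s) = a - w - of_real s"
    by (simp_all add: complex_eq_height cos_60)
  show "(\<lambda>z. a - z) ` up_triangle s w = down_triangle s (a - w - of_real s)"
    unfolding up_triangle_def down_triangle_def ** image_insert image_empty
    by (subst (1) e(1), subst e(2), subst e(4)) (simp add: insert_commute)
  show "(\<lambda>z. a - z) ` down_triangle s w = up_triangle s (a - w - of_real s)"
    unfolding up_triangle_def down_triangle_def ** image_insert image_empty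
    by (subst (1) e(1), subst e(3), subst e(4)) (simp add: insert_commute)
  show "(\<lambda>z. z + d) ` up_triangle s w = up_triangle s (w + d)"
    "(\<lambda>z. z + d) ` down_triangle s w = down_triangle s (w + d)"
    unfolding up_triangle_def down_triangle_def * by (simp_all add: algebra_simps)
qed

text \<open>
  The half-turn about the origin turns this into the description of an upward-pointing triangle.
\<close>

lemma down_triangle_iff:
  assumes "s > 0"
  shows "z \<in> down_triangle s w \<longleftrightarrow> height z \<le> height w \<and>
    height w - height z \<le> 2 * (Re z - Re w) \<and> 2 * (Re z - Re w) + (height w - height z) \<le> 2 * s"
proof -
  have "z \<in> down_triangle s w \<longleftrightarrow> z \<in> (\<lambda>z. 0 - z) ` up_triangle s (0 - w - of_real s)"
    unfolding half_turn_up_triangle by simp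
  also have "\<dots> \<longleftrightarrow> - z \<in> up_triangle s (- w - of_real s)"
    by (auto simp: image_iff intro: bexI[of _ "- z"])
  finally show ?thesis
    using up_triangle_iff[OF assms, of "- z" "- w - of_real s"] by auto
qed

text \<open>
  The index vertex is recovered as the leftmost among the lowest points of the triangle.
\<close>

lemma up_triangle_inj:
  assumes "s > 0" shows "up_triangle s w = up_triangle s w' \<longleftrightarrow> w = w'"
proof
  assume "up_triangle s w = up_triangle s w'"
  moreover have "w \<in> up_triangle s w" "w' \<in> up_triangle s w'"
    using assms by (simp_all add: up_triangle_iff)
  ultimately have "w \<in> up_triangle s w'" "w' \<in> up_triangle s w"
    by auto
  then show "w = w'"
    using assms by (simp add: up_triangle_iff complex_eq_height)
qed simp

lemma down_triangle_inj:
  assumes "s > 0" shows "down_triangle s w = down_triangle s w' \<longleftrightarrow> w = w'"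
proof
  assume "down_triangle s w = down_triangle s w'"
  moreover have "w \<in> down_triangle s w" "w' \<in> down_triangle s w'"
    using assms by (simp_all add: down_triangle_iff)
  ultimately have "w \<in> down_triangle s w'" "w' \<in> down_triangle s w"
    by auto
  then show "w = w'"
    using assms by (simp add: down_triangle_iff complex_eq_height)
qed simp

text \<open>
  The horizontal width of the triangle shrinks with the height, so a horizontal segment of length
  \<open>s\<close> fits only at the bottom. Hence each triangle has exactly one horizontal edge, and its
  neighbour across that edge is determined.
\<close>

lemma horizontal_edge_subset_up_iff:
  assumes "s > 0"
  shows "closed_segment x (x + of_real s) \<subseteq> up_triangle s w \<longleftrightarrow> x = w"
proof
  assume "closed_segment x (x + of_real s) \<subseteq> up_triangle s w"
  then have "x \<in> up_triangle s w" "x + of_real s \<in> up_triangle s w"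
    by auto
  then show "x = w"
    using assms unfolding up_triangle_iff[OF assms] complex_eq_height by auto
next
  assume "x = w"
  then show "closed_segment x (x + of_real s) \<subseteq> up_triangle s w"
    unfolding up_triangle_def segment_convex_hull by (auto intro!: hull_mono)
qed

lemma horizontal_edge_subset_down_iff:
  assumes "s > 0"
  shows "closed_segment x (x + of_real s) \<subseteq> down_triangle s w \<longleftrightarrow> x = w"
proof
  assume "closed_segment x (x + of_real s) \<subseteq> down_triangle s w"
  then have "x \<in> down_triangle s w" "x + of_real s \<in> down_triangle s w"
    by auto
  then show "x = w"
    using assms unfolding down_triangle_iff[OF assms] complex_eq_height by auto
next
  assume "x = w"
  then show "closed_segment x (x + of_real s) \<subseteq> down_triangle s w"
    unfolding down_triangle_def segment_convex_hull by (auto intro!: hull_mono)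
qed

text \<open>
  If they were equal, the horizontal edges would agree, but the apices lie on opposite sides of
  that edge.
\<close>

lemma up_neq_down:
  assumes "s > 0" shows "up_triangle s w \<noteq> down_triangle s w'"
proof
  assume eq: "up_triangle s w = down_triangle s w'"
  then have "w = w'"
    using horizontal_edge_subset_up_iff[OF assms, of w w]
      horizontal_edge_subset_down_iff[OF assms, of w w'] by simp
  moreover have "w + of_real s * cis (pi / 3) \<in> up_triangle s w"
    using assms by (simp add: up_triangle_iff cos_60)
  ultimately have "w + of_real s * cis (pi / 3) \<in> down_triangle s w"
    using eq by simp
  then show False
    using assms by (simp add: down_triangle_iff)
qed

lemmas triangle_simps = up_triangle_inj down_triangle_inj up_neq_down up_neq_down[symmetric]

lemma triangles_cases:
  assumes "t \<in> triangles c s"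
  obtains w where "w \<in> vertices c s" "t = up_triangle s w"
    | w where "w \<in> vertices c s" "t = down_triangle s w"
  using assms by (auto simp: triangles_def up_triangles_def down_triangles_def)

lemma triangles_intros:
  "w \<in> vertices c s \<Longrightarrow> up_triangle s w \<in> triangles c s"
  "w \<in> vertices c s \<Longrightarrow> down_triangle s w \<in> triangles c s"
  by (auto simp: triangles_def up_triangles_def down_triangles_def)

section \<open>The Schritte-Wechsel group\<close>

lemma schritt_up: "w \<in> vertices c s \<Longrightarrow> schritt c s d (up_triangle s w) = up_triangle s (w + d)"
  by (simp add: schritt_def triangles_intros translate_up_triangle up_triangles_def)

lemma schritt_down:
  assumes "s > 0" "w \<in> vertices c s"
  shows "schritt c s d (down_triangle s w) = down_triangle s (w - d)"
proof -
  have "down_triangle s w \<notin> up_triangles c s"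
    using assms by (auto simp: up_triangles_def triangle_simps)
  then show ?thesis
    using assms translate_down_triangle[of "- d" s w] by (simp add: schritt_def triangles_intros)
qed

lemma seitenwechsel_up:
  assumes s: "s > 0" and w: "w \<in> vertices c s"
  shows "seitenwechsel c s (up_triangle s w) = down_triangle s w"
proof -
  have "(THE t'. t' \<in> triangles c s \<and> t' \<noteq> up_triangle s w \<and>
      (\<exists>e\<in>horizontal_edges c s. e \<subseteq> up_triangle s w \<and> e \<subseteq> t')) = down_triangle s w"
  proof (rule the_equality)
    fix t' assume "t' \<in> triangles c s \<and> t' \<noteq> up_triangle s w \<and>
      (\<exists>e\<in>horizontal_edges c s. e \<subseteq> up_triangle s w \<and> e \<subseteq> t')"
    then show "t' = down_triangle s w"
      using s by (auto elim!: triangles_cases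
          simp: horizontal_edges_def horizontal_edge_subset_up_iff horizontal_edge_subset_down_iff)
  qed (use assms in \<open>auto simp: horizontal_edges_def horizontal_edge_subset_up_iff
         horizontal_edge_subset_down_iff triangles_intros triangle_simps\<close>)
  then show ?thesis
    using w by (simp add: seitenwechsel_def triangles_intros)
qed

lemma seitenwechsel_down:
  assumes s: "s > 0" and w: "w \<in> vertices c s"
  shows "seitenwechsel c s (down_triangle s w) = up_triangle s w"
proof -
  have "(THE t'. t' \<in> triangles c s \<and> t' \<noteq> down_triangle s w \<and>
      (\<exists>e\<in>horizontal_edges c s. e \<subseteq> down_triangle s w \<and> e \<subseteq> t')) = up_triangle s w"
  proof (rule the_equality)
    fix t' assume "t' \<in> triangles c s \<and> t' \<noteq> down_triangle s w \<and>
      (\<exists>e\<in>horizontal_edges c s. e \<subseteq> down_triangle s w \<and> e \<subseteq> t')"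
    then show "t' = up_triangle s w"
      using s by (auto elim!: triangles_cases
          simp: horizontal_edges_def horizontal_edge_subset_up_iff horizontal_edge_subset_down_iff)
  qed (use assms in \<open>auto simp: horizontal_edges_def horizontal_edge_subset_up_iff
         horizontal_edge_subset_down_iff triangles_intros triangle_simps\<close>)
  then show ?thesis
    using w by (simp add: seitenwechsel_def triangles_intros)
qed

lemma schritt_Bij:
  assumes s: "s > 0" and d: "d \<in> periods s"
  shows "schritt c s d \<in> Bij (triangles c s)"
proof -
  have "schritt c s d t \<in> triangles c s \<and> schritt c s (- d) (schritt c s d t) = t"
    if d: "d \<in> periods s" and "t \<in> triangles c s" for d t
    using that(2)
    by (cases rule: triangles_cases)
      (simp_all add: s d schritt_up schritt_down vertices_add vertices_diff_period triangles_intros)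
  from this[OF d] this[OF periods_uminus[OF d]] show ?thesis
    by (intro BijI[where g = "schritt c s (- d)"]) (simp_all, simp add: schritt_def)
qed

lemma seitenwechsel_Bij:
  assumes "s > 0" shows "seitenwechsel c s \<in> Bij (triangles c s)"
proof -
  have "seitenwechsel c s t \<in> triangles c s \<and> seitenwechsel c s (seitenwechsel c s t) = t"
    if "t \<in> triangles c s" for t
    using that
    by (cases rule: triangles_cases)
      (simp_all add: assms seitenwechsel_up seitenwechsel_down triangles_intros)
  then show ?thesis
    by (intro BijI[where g = "seitenwechsel c s"]) (simp_all, simp add: seitenwechsel_def)
qed

text \<open>
  The vectors \<open>d\<close> whose Schritt lies in the group form an additive group, because Schritte compose
  by adding their vectors; the Quintschritt and the Terzschritt supply the two lattice generators.
\<close>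

lemma schritt_in_schritte_wechsel_group:
  assumes s: "s > 0" and d: "d \<in> periods s"
  shows "schritt c s d \<in> carrier (schritte_wechsel_group c s)"
proof -
  let ?B = "BijGroup (triangles c s)"
  let ?D = "{d \<in> periods s. schritt c s d \<in> carrier (schritte_wechsel_group c s)}"
  interpret B: group ?B
    by (rule group_BijGroup)
  interpret R: group "schritte_wechsel_group c s"
    unfolding schritte_wechsel_group_def by simp
  have gen: "quintschritt c s \<in> carrier (schritte_wechsel_group c s)"
    "terzschritt c s \<in> carrier (schritte_wechsel_group c s)"
    unfolding schritte_wechsel_group_def carrier_subgroup_generated
    using s by (auto intro!: generate.incl
        simp: carrier_BijGroup quintschritt_def terzschritt_def schritt_Bij periods_generators)
  have mult: "schritt c s d \<otimes>\<^bsub>schritte_wechsel_group c s\<^esub> schritt c s d' = schritt c s (d + d')"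
    if d: "d \<in> periods s" "d' \<in> periods s" for d d'
  proof -
    have "compose (triangles c s) (schritt c s d) (schritt c s d') t = schritt c s (d + d') t"
      if "t \<in> triangles c s" for t
      using that
      by (cases rule: triangles_cases)
        (simp_all add: compose_eq s d schritt_up schritt_down vertices_add vertices_diff_period
          triangles_intros algebra_simps)
    then have "compose (triangles c s) (schritt c s d) (schritt c s d') = schritt c s (d + d')"
      by (intro extensionalityI[where A = "triangles c s"]) (auto simp: schritt_def)
    then show ?thesis
      using s d by (simp add: schritte_wechsel_group_def BijGroup_mult schritt_Bij)
  qed
  have one: "schritt c s 0 = \<one>\<^bsub>schritte_wechsel_group c s\<^esub>"
    by (auto simp: schritte_wechsel_group_def BijGroup_def schritt_def intro!: restrict_ext split: if_splits)
  have "periods s \<subseteq> ?D"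
  proof (rule periods_minimal)
    fix d assume "d \<in> ?D"
    then have d: "d \<in> periods s" "schritt c s d \<in> carrier (schritte_wechsel_group c s)" "- d \<in> periods s"
      by (auto intro: periods_uminus)
    have "inv\<^bsub>?B\<^esub> (schritt c s d) = schritt c s (- d)"
      using mult[of "- d" d] one d s by (intro B.inv_equality)
        (auto simp: schritte_wechsel_group_def carrier_BijGroup schritt_Bij)
    moreover have "inv\<^bsub>?B\<^esub> (schritt c s d) = inv\<^bsub>schritte_wechsel_group c s\<^esub> (schritt c s d)"
      using d unfolding schritte_wechsel_group_def by simp
    ultimately show "- d \<in> ?D"
      using d R.inv_closed[of "schritt c s d"] by simp
  next
    fix d d' assume "d \<in> ?D" "d' \<in> ?D"
    then show "d + d' \<in> ?D"
      using mult[of d d'] R.m_closed[of "schritt c s d" "schritt c s d'"] by (auto simp: periods_add)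
  qed (use gen one in \<open>auto simp: quintschritt_def terzschritt_def periods_generators periods_zero\<close>)
  then show ?thesis
    using d by blast
qed

text \<open>
  The group consists of permutations of the triangles, so its action is the inclusion into
  \<^term>\<open>BijGroup (triangles c s)\<close>, which is trivially faithful.
\<close>

lemma schritte_wechsel_group_actions:
  assumes s: "s > 0"
  shows "faithful_action (schritte_wechsel_group c s) (triangles c s) (\<lambda>r. r)"
    and "transitive_action (schritte_wechsel_group c s) (triangles c s) (\<lambda>r. r)"
proof -
  let ?R = "schritte_wechsel_group c s"
  interpret B: group "BijGroup (triangles c s)"
    by (rule group_BijGroup)
  interpret R: group ?R
    unfolding schritte_wechsel_group_def by simp
  have "carrier ?R \<subseteq> carrier (BijGroup (triangles c s))"
    unfolding schritte_wechsel_group_def by (rule B.carrier_subgroup_generated_subset)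
  then have "group_hom ?R (BijGroup (triangles c s)) (\<lambda>r. r)"
    by unfold_locales (auto simp: hom_def schritte_wechsel_group_def)
  then have act: "group_action ?R (triangles c s) (\<lambda>r. r)"
    by (rule group_action.intro)
  then show "faithful_action ?R (triangles c s) (\<lambda>r. r)"
    by (auto intro!: faithful_action.intro faithful_action_axioms.intro)
  have W: "seitenwechsel c s \<in> carrier ?R"
    unfolding schritte_wechsel_group_def carrier_subgroup_generated
    using s by (auto intro!: generate.incl simp: carrier_BijGroup seitenwechsel_Bij)
  have c: "c \<in> vertices c s"
    by (simp add: vertices_iff periods_zero)
  show "transitive_action ?R (triangles c s) (\<lambda>r. r)"
  proof (rule transitive_actionI[OF act triangles_intros(1)[OF c]])
    fix t assume "t \<in> triangles c s"
    then show "\<exists>r\<in>carrier ?R. r (up_triangle s c) = t"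
    proof (cases rule: triangles_cases)
      case (1 w)
      then show ?thesis
        using schritt_in_schritte_wechsel_group[OF s, of "w - c" c] schritt_up[OF c, of "w - c"]
        by (auto simp: vertices_iff)
    next
      case (2 w)
      let ?S = "schritt c s (w - c)"
      have S: "?S \<in> carrier ?R"
        using schritt_in_schritte_wechsel_group[OF s, of "w - c" c] 2 by (simp add: vertices_iff)
      have "(seitenwechsel c s \<otimes>\<^bsub>?R\<^esub> ?S) (up_triangle s c) = seitenwechsel c s (?S (up_triangle s c))"
        using group_action.composition_rule[OF act triangles_intros(1)[OF c] W S] .
      also have "\<dots> = t"
        using 2 s c by (simp add: schritt_up seitenwechsel_up)
      finally show ?thesis
        using R.m_closed[OF W S] by blast
    qed
  qed
qed

section \<open>The point reflection group\<close>

text \<open>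
  The translations by lattice vectors and the half-turns about the points \<open>v + d / 2\<close>; if \<open>v\<close> is
  a vertex of the tiling, these centres are the vertices and the midpoints of the edges.
\<close>

definition motions :: "real \<Rightarrow> complex \<Rightarrow> (complex \<Rightarrow> complex) set" where
  "motions s v = (\<lambda>d z. z + d) ` periods s \<union> (\<lambda>d z. 2 * v + d - z) ` periods s"

lemma motions_cases:
  assumes "p \<in> motions s v"
  obtains d where "d \<in> periods s" "p = (\<lambda>z. z + d)" | d where "d \<in> periods s" "p = (\<lambda>z. 2 * v + d - z)"
  using assms by (auto simp: motions_def)

lemma motions_intros:
  "d \<in> periods s \<Longrightarrow> (\<lambda>z. z + d) \<in> motions s v"
  "d \<in> periods s \<Longrightarrow> (\<lambda>z. 2 * v + d - z) \<in> motions s v"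
  by (auto simp: motions_def)

lemma group_isometry_group: "group isometry_group"
proof (rule groupI)
  fix f assume "f \<in> carrier isometry_group"
  then have f: "bij f" "\<And>x y. dist (f x) (f y) = dist x y"
    by (auto simp: isometry_group_def)
  have "dist (inv_into UNIV f x) (inv_into UNIV f y) = dist x y" for x y
    using f(2)[of "inv_into UNIV f x" "inv_into UNIV f y"] f(1) by (simp add: bij_is_surj surj_f_inv_f)
  then show "\<exists>g\<in>carrier isometry_group. g \<otimes>\<^bsub>isometry_group\<^esub> f = \<one>\<^bsub>isometry_group\<^esub>"
    using f(1) by (intro bexI[of _ "inv_into UNIV f"]) (auto simp: isometry_group_def bij_imp_bij_inv bij_is_inj)
qed (auto simp: isometry_group_def bij_comp comp_assoc)

lemma motions_subset_isometries: "motions s v \<subseteq> carrier isometry_group"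
proof
  fix p assume "p \<in> motions s v"
  then show "p \<in> carrier isometry_group"
  proof (cases rule: motions_cases)
    case (1 d)
    then have "bij p"
      by (intro bij_betw_byWitness[where f' = "\<lambda>z. z - d"]) auto
    then show ?thesis
      using 1 by (simp add: isometry_group_def)
  next
    case (2 d)
    then have "bij p"
      by (intro bij_betw_byWitness[where f' = p]) auto
    then show ?thesis
      using 2 by (simp add: isometry_group_def dist_norm norm_minus_commute)
  qed
qed

lemma motions_comp:
  assumes p: "p \<in> motions s v" and q: "q \<in> motions s v" shows "p \<circ> q \<in> motions s v"
  using p
proof (cases rule: motions_cases)
  case p: (1 d)
  show ?thesis using q
  proof (cases rule: motions_cases)
    case (1 e)
    then have "p \<circ> q = (\<lambda>z. z + (e + d))"
      using p by (simp add: fun_eq_iff)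
    then show ?thesis
      using p 1 by (simp only: motions_intros periods_add)
  next
    case (2 e)
    then have "p \<circ> q = (\<lambda>z. 2 * v + (e + d) - z)"
      using p by (simp add: fun_eq_iff)
    then show ?thesis
      using p 2 by (simp only: motions_intros periods_add)
  qed
next
  case p: (2 d)
  show ?thesis using q
  proof (cases rule: motions_cases)
    case (1 e)
    then have "p \<circ> q = (\<lambda>z. 2 * v + (d - e) - z)"
      using p by (simp add: fun_eq_iff)
    then show ?thesis
      using p 1 by (simp only: motions_intros periods_diff)
  next
    case (2 e)
    then have "p \<circ> q = (\<lambda>z. z + (d - e))"
      using p by (simp add: fun_eq_iff)
    then show ?thesis
      using p 2 by (simp only: motions_intros periods_diff)
  qed
qed

lemma motions_inverse:
  assumes "p \<in> motions s v" shows "\<exists>q \<in> motions s v. q \<circ> p = id \<and> p \<circ> q = id"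
  using assms
proof (cases rule: motions_cases)
  case (1 d)
  then show ?thesis
    by (intro bexI[of _ "\<lambda>z. z + (- d)"] motions_intros periods_uminus) (auto simp: fun_eq_iff)
next
  case (2 d)
  then show ?thesis
    using assms by (intro bexI[of _ p]) (auto simp: fun_eq_iff)
qed

lemma subgroup_motions: "subgroup (motions s v) isometry_group"
proof -
  interpret group isometry_group
    by (rule group_isometry_group)
  show ?thesis
  proof (rule subgroupI)
    show "motions s v \<noteq> {}"
      using motions_intros(1)[OF periods_zero] by blast
    show "inv\<^bsub>isometry_group\<^esub> p \<in> motions s v" if p: "p \<in> motions s v" for p
    proof -
      obtain q where q: "q \<in> motions s v" "q \<circ> p = id"
        using motions_inverse[OF p] by blast
      then have "inv\<^bsub>isometry_group\<^esub> p = q"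
        using p motions_subset_isometries[of s v] by (intro inv_equality) (auto simp: isometry_group_def)
      then show ?thesis
        using q by simp
    qed
    show "p \<otimes>\<^bsub>isometry_group\<^esub> q \<in> motions s v" if "p \<in> motions s v" "q \<in> motions s v" for p q
      using motions_comp[OF that] by (simp add: isometry_group_def)
  qed (rule motions_subset_isometries)
qed

lemma half_turn_midpoint: "half_turn (midpoint x y) = (\<lambda>z. x + y - z)"
  by (simp add: half_turn_def midpoint_def fun_eq_iff scaleR_conv_of_real field_simps)

text \<open>
  The three generators are \<open>z \<mapsto> 2 * v + d - z\<close>, where \<open>d\<close> is \<open>a = s\<close>, \<open>b = s * cis (pi / 3)\<close> or
  \<open>a + b\<close>. The composite of two of them is the translation by the difference of their vectors,
  which gives \<open>a\<close> and \<open>b\<close> and hence all lattice translations; these combine with one half-turn to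
  give all the others.
\<close>

lemma carrier_point_reflection_group: "carrier (point_reflection_group s v) = motions s v"
proof
  interpret I: group isometry_group
    by (rule group_isometry_group)
  interpret P: group "point_reflection_group s v"
    unfolding point_reflection_group_def by simp
  let ?a = "of_real s" and ?b = "of_real s * cis (pi / 3)"
  let ?h = "\<lambda>d z. 2 * v + d - z"
  have gens: "{half_turn (midpoint v (v + ?a)), half_turn (midpoint v (v + ?b)),
      half_turn (midpoint (v + ?a) (v + ?b))} = {?h ?a, ?h ?b, ?h (?a + ?b)}"
    unfolding half_turn_midpoint by (simp add: algebra_simps)
  have h: "?h ?a \<in> motions s v" "?h ?b \<in> motions s v" "?h (?a + ?b) \<in> motions s v"
    by (intro motions_intros periods_generators periods_add)+
  then show "carrier (point_reflection_group s v) \<subseteq> motions s v"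
    unfolding point_reflection_group_def carrier_subgroup_generated gens
    by (intro I.generate_subgroup_incl subgroup_motions) auto
  have P: "?h ?a \<in> carrier (point_reflection_group s v)" "?h ?b \<in> carrier (point_reflection_group s v)"
      "?h (?a + ?b) \<in> carrier (point_reflection_group s v)"
    unfolding point_reflection_group_def carrier_subgroup_generated gens
    using h motions_subset_isometries by (auto intro!: generate.incl)
  have mult: "p \<otimes>\<^bsub>point_reflection_group s v\<^esub> q = p \<circ> q" for p q
    by (simp add: point_reflection_group_def isometry_group_def)
  have closed: "p \<circ> q \<in> carrier (point_reflection_group s v)"
    if "p \<in> carrier (point_reflection_group s v)" "q \<in> carrier (point_reflection_group s v)" for p q
    using P.m_closed[OF that] by (simp add: mult)
  let ?D = "{d. (\<lambda>z. z + d) \<in> carrier (point_reflection_group s v)}"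
  have "periods s \<subseteq> ?D"
  proof (rule periods_minimal)
    have "?h (?a + ?b) \<circ> ?h ?b = (\<lambda>z. z + ?a)" "?h (?a + ?b) \<circ> ?h ?a = (\<lambda>z. z + ?b)"
      "?h ?a \<circ> ?h ?a = (\<lambda>z. z + 0)"
      by (auto simp: fun_eq_iff)
    then show "?a \<in> ?D" "?b \<in> ?D" "0 \<in> ?D"
      using closed[OF P(3) P(2)] closed[OF P(3) P(1)] closed[OF P(1) P(1)] by (simp_all only: mem_Collect_eq)
  next
    fix d e assume "d \<in> ?D" "e \<in> ?D"
    then have "(\<lambda>z. z + e) \<circ> (\<lambda>z. z + d) \<in> carrier (point_reflection_group s v)"
      by (intro closed) simp_all
    moreover have "(\<lambda>z. z + e) \<circ> (\<lambda>z. z + d) = (\<lambda>z. z + (d + e))"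
      by (auto simp: fun_eq_iff)
    ultimately show "d + e \<in> ?D"
      by (simp only: mem_Collect_eq)
  next
    fix d assume "d \<in> ?D"
    \<comment> \<open>Conjugation by a half-turn inverts a translation.\<close>
    then have "?h ?a \<circ> (\<lambda>z. z + d) \<circ> ?h ?a \<in> carrier (point_reflection_group s v)"
      by (intro closed P) simp_all
    moreover have "?h ?a \<circ> (\<lambda>z. z + d) \<circ> ?h ?a = (\<lambda>z. z + (- d))"
      by (auto simp: fun_eq_iff)
    ultimately show "- d \<in> ?D"
      by (simp only: mem_Collect_eq)
  qed
  then have trans: "(\<lambda>z. z + d) \<in> carrier (point_reflection_group s v)" if "d \<in> periods s" for d
    using that by blast
  show "motions s v \<subseteq> carrier (point_reflection_group s v)"
  proof
    fix p assume "p \<in> motions s v"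
    then show "p \<in> carrier (point_reflection_group s v)"
    proof (cases rule: motions_cases)
      case (2 d)
      have "p = (\<lambda>z. z + (d - ?a)) \<circ> ?h ?a"
        using 2 by (simp add: fun_eq_iff)
      moreover have "(\<lambda>z. z + (d - ?a)) \<in> carrier (point_reflection_group s v)"
        using 2 by (intro trans periods_diff periods_generators)
      ultimately show ?thesis
        using closed P(1) by blast
    qed (use trans in simp)
  qed
qed

section \<open>The action of the point reflection group on triangles\<close>

context
  fixes c v :: complex and s :: real
  assumes s: "s > 0" and v: "v \<in> vertices c s"
begin

lemma reflected_vertex:
  assumes "w \<in> vertices c s" "d \<in> periods s"
  shows "2 * v + d - w - of_real s \<in> vertices c s"
proof -
  have "v + ((v - w) + (d - of_real s)) \<in> vertices c s"
    using assms v by (intro vertices_add periods_add periods_diff vertices_diff periods_generators)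
  then show ?thesis
    by (simp add: algebra_simps)
qed

lemma motion_image_triangle:
  assumes p: "p \<in> motions s v" and t: "t \<in> triangles c s"
  shows "p ` t \<in> triangles c s"
  using p
proof (cases rule: motions_cases)
  case (1 d)
  from t show ?thesis
    by (cases rule: triangles_cases)
      (simp_all add: 1 translate_up_triangle translate_down_triangle vertices_add triangles_intros)
next
  case (2 d)
  from t show ?thesis
    by (cases rule: triangles_cases)
      (simp_all add: 2 half_turn_up_triangle half_turn_down_triangle reflected_vertex triangles_intros)
qed

text \<open>
  For a half-turn, \<open>up_triangle s w\<close> goes to \<open>down_triangle s (2 * v + d - w - s)\<close>, and adding \<open>e\<close>
  to \<open>w\<close> amounts to subtracting \<open>e\<close> from the index of the image, as a Schritt does on
  downward-pointing triangles.
\<close>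

lemma motion_commutes_schritt:
  assumes p: "p \<in> motions s v" and t: "t \<in> triangles c s" and e: "e \<in> periods s"
  shows "p ` schritt c s e t = schritt c s e (p ` t)"
  using p
proof (cases rule: motions_cases)
  case (1 d)
  from t show ?thesis
    by (cases rule: triangles_cases)
      (simp_all add: 1 s schritt_up schritt_down translate_up_triangle translate_down_triangle
        vertices_add algebra_simps)
next
  case (2 d)
  from t show ?thesis
    by (cases rule: triangles_cases)
      (simp_all add: 2 s schritt_up schritt_down half_turn_up_triangle half_turn_down_triangle
        reflected_vertex, simp_all add: algebra_simps)
qed

lemma motion_commutes_seitenwechsel:
  assumes p: "p \<in> motions s v" and t: "t \<in> triangles c s"
  shows "p ` seitenwechsel c s t = seitenwechsel c s (p ` t)"
  using p
proof (cases rule: motions_cases)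
  case (1 d)
  from t show ?thesis
    by (cases rule: triangles_cases)
      (simp_all add: 1 s seitenwechsel_up seitenwechsel_down translate_up_triangle
        translate_down_triangle vertices_add)
next
  case (2 d)
  from t show ?thesis
    by (cases rule: triangles_cases)
      (simp_all add: 2 s seitenwechsel_up seitenwechsel_down half_turn_up_triangle
        half_turn_down_triangle reflected_vertex)
qed

lemma motion_image_Bij:
  assumes p: "p \<in> motions s v"
  shows "(\<lambda>t\<in>triangles c s. p ` t) \<in> Bij (triangles c s)"
proof -
  obtain q where q: "q \<in> motions s v" "q \<circ> p = id" "p \<circ> q = id"
    using motions_inverse[OF p] by blast
  then show ?thesis
    using p by (intro BijI[where g = "\<lambda>t. q ` t"]) (simp_all add: motion_image_triangle image_comp)
qed

text \<open>
  A motion in \<open>motions s v\<close> is already determined by the image of the base triangle: its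
  orientation tells translations from half-turns, and its index vertex gives the vector.
\<close>

lemma point_reflection_group_actions:
  shows "faithful_action (point_reflection_group s v) (triangles c s) (\<lambda>p. \<lambda>t\<in>triangles c s. p ` t)"
    and "transitive_action (point_reflection_group s v) (triangles c s) (\<lambda>p. \<lambda>t\<in>triangles c s. p ` t)"
proof -
  let ?P = "point_reflection_group s v" and ?T = "triangles c s"
  let ?\<alpha> = "\<lambda>p. \<lambda>t\<in>?T. p ` t"
  interpret I: group isometry_group
    by (rule group_isometry_group)
  interpret P: group ?P
    unfolding point_reflection_group_def by simp
  interpret B: group "BijGroup ?T"
    by (rule group_BijGroup)
  have mult: "p \<otimes>\<^bsub>?P\<^esub> q = p \<circ> q" for p q
    by (simp add: point_reflection_group_def isometry_group_def)
  have hom: "group_hom ?P (BijGroup ?T) ?\<alpha>"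
  proof (unfold_locales, rule homI)
    fix p q assume "p \<in> carrier ?P" "q \<in> carrier ?P"
    then have pq: "p \<in> motions s v" "q \<in> motions s v"
      by (simp_all add: carrier_point_reflection_group)
    then show "?\<alpha> (p \<otimes>\<^bsub>?P\<^esub> q) = ?\<alpha> p \<otimes>\<^bsub>BijGroup ?T\<^esub> ?\<alpha> q"
      by (auto simp: BijGroup_mult motion_image_Bij mult compose_def motion_image_triangle image_comp
          intro!: restrict_ext)
  qed (simp add: carrier_BijGroup carrier_point_reflection_group motion_image_Bij)
  then have act: "group_action ?P ?T ?\<alpha>"
    by (rule group_action.intro)
  have up: "up_triangle s v \<in> ?T"
    using v by (rule triangles_intros)
  have "p = q" if "p \<in> motions s v" "q \<in> motions s v" "p ` up_triangle s v = q ` up_triangle s v" for p q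
    using that s
    by (auto elim!: motions_cases simp: half_turn_up_triangle translate_up_triangle triangle_simps)
  then have "inj_on ?\<alpha> (carrier ?P)"
    using up by (metis (no_types, lifting) carrier_point_reflection_group inj_onI restrict_apply')
  with act show "faithful_action ?P ?T ?\<alpha>"
    by (intro faithful_action.intro faithful_action_axioms.intro)
  show "transitive_action ?P ?T ?\<alpha>"
  proof (rule transitive_actionI[OF act up])
    fix t assume "t \<in> ?T"
    then have "\<exists>p\<in>motions s v. p ` up_triangle s v = t"
    proof (cases rule: triangles_cases)
      case (1 w)
      then show ?thesis
        using v by (intro bexI[of _ "\<lambda>z. z + (w - v)"] motions_intros vertices_diff)
          (simp_all add: translate_up_triangle)
    next
      case (2 w)
      have "w - v + of_real s \<in> periods s"
        using 2 v by (intro periods_add vertices_diff periods_generators)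
      then show ?thesis
        using 2 by (intro bexI[of _ "\<lambda>z. 2 * v + (w - v + of_real s) - z"] motions_intros)
          (simp_all add: half_turn_up_triangle)
    qed
    then show "\<exists>p\<in>carrier ?P. ?\<alpha> p (up_triangle s v) = t"
      using up by (simp add: carrier_point_reflection_group)
  qed
qed

text \<open>
  By \<open>commutes_with_subgroup_generated\<close>, applied in the group of permutations of the triangles, it
  suffices to let \<open>r\<close> be the Quintschritt, the Terzschritt or the Seitenwechsel.
\<close>

lemma actions_commute:
  assumes p: "p \<in> motions s v" and r: "r \<in> carrier (schritte_wechsel_group c s)"
    and t: "t \<in> triangles c s"
  shows "p ` r t = r (p ` t)"
proof -
  let ?T = "triangles c s" and ?p = "\<lambda>t\<in>triangles c s. p ` t"
  interpret B: group "BijGroup ?T"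
    by (rule group_BijGroup)
  note pB = motion_image_Bij[OF p]
  have *: "?p \<otimes>\<^bsub>BijGroup ?T\<^esub> g = g \<otimes>\<^bsub>BijGroup ?T\<^esub> ?p"
    if "g \<in> Bij ?T" "\<And>t. t \<in> ?T \<Longrightarrow> p ` g t = g (p ` t)" for g
    using that pB funcset_mem[OF Bij_imp_funcset[OF that(1)]]
    by (simp add: BijGroup_mult compose_def motion_image_triangle[OF p] cong: restrict_cong)
  have "?p \<otimes>\<^bsub>BijGroup ?T\<^esub> r = r \<otimes>\<^bsub>BijGroup ?T\<^esub> ?p"
  proof (rule B.commutes_with_subgroup_generated)
    show "r \<in> carrier (subgroup_generated (BijGroup ?T)
        {quintschritt c s, terzschritt c s, seitenwechsel c s})"
      using r by (simp add: schritte_wechsel_group_def)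
    fix g assume "g \<in> {quintschritt c s, terzschritt c s, seitenwechsel c s}"
      and gB: "g \<in> carrier (BijGroup ?T)"
    then have "p ` g t = g (p ` t)" if "t \<in> ?T" for t
      using p that by (elim insertE emptyE) (simp_all add: quintschritt_def terzschritt_def
          motion_commutes_schritt motion_commutes_seitenwechsel periods_generators)
    then show "?p \<otimes>\<^bsub>BijGroup ?T\<^esub> g = g \<otimes>\<^bsub>BijGroup ?T\<^esub> ?p"
      using gB by (intro *) (simp_all add: carrier_BijGroup)
  qed (simp add: carrier_BijGroup pB)
  moreover have rB: "r \<in> Bij ?T"
    using r B.carrier_subgroup_generated_subset by (auto simp: schritte_wechsel_group_def carrier_BijGroup)
  ultimately have "compose ?T ?p r t = compose ?T r ?p t"
    using pB by (simp add: BijGroup_mult)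
  moreover have "r t \<in> ?T"
    using Bij_imp_funcset[OF rB] t by blast
  ultimately show ?thesis
    using t by (simp add: compose_eq)
qed

end

section \<open>The anti-isomorphism\<close>

theorem proposition6p1:
  fixes c v :: complex and s :: real
  assumes "s > 0" and "v \<in> vertices c s"
  shows "\<exists>\<phi> \<in> iso (point_reflection_group s v) (opposite_group (schritte_wechsel_group c s)).
           \<forall>p \<in> carrier (point_reflection_group s v). \<forall>r \<in> carrier (schritte_wechsel_group c s).
             \<phi> p = r \<longleftrightarrow> r (up_triangle s v) = p ` up_triangle s v"
proof -
  let ?T = "triangles c s"
  have up: "up_triangle s v \<in> ?T"
    using assms(2) by (rule triangles_intros)
  have comm: "(\<lambda>t\<in>?T. p ` t) (r t) = r ((\<lambda>t\<in>?T. p ` t) t)"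
    if "p \<in> carrier (point_reflection_group s v)" "r \<in> carrier (schritte_wechsel_group c s)" "t \<in> ?T"
    for p r t
    using actions_commute[OF assms, of p r t] that carrier_point_reflection_group
      group_action.element_image[OF faithful_action.axioms(1)[OF schritte_wechsel_group_actions(1)[OF assms(1)]]]
    by auto
  show ?thesis
    using commuting_transitive_actions_anti_iso[OF point_reflection_group_actions[OF assms]
        schritte_wechsel_group_actions[OF assms(1)] comm up] up
    by simp
qed

end
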